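(* Let $X$ and $Y$ be real-valued random variables whose joint CDF $F_{XY}(x,y)$ is an absolutely continuous CDF on $\mathbb{R}^2$, with support sets $\{S_{XY}, S_X, S_Y\}$ and canonical PDF versions $f_{XY}^{C}(x,y)$, $f_X^{C}(x)$ and $f_Y^{C}(y)$. If $X$ and $Y$ are independent, then $$S_{XY} = S_X\times S_Y .$$
   Context: The underlying probability space is $(\mathbb{R}^2, \mathbb{B}^2, P)$, where $\mathbb{B}^k$ denotes the Borel $\sigma$-field on $\mathbb{R}^k$; $X$ and $Y$ are the two coordinate maps, so $P$ is the joint distribution of $(X,Y)$. $F_{XY}(x,y)=P(X\le x \text{ and } Y\le y)$, $F_X(x)=P(X\le x)$, $F_Y(y)=P(Y\le y)$. $F_{XY}$ is absolutely continuous if the probability measure it induces on $\mathbb{R}^2$ is absolutely continuous with respect to two-dimensional Lebesgue measure. $X$ and $Y$ are independent iff $P[(X\in B_1) \text{ and } (Y\in B_2)] = P(X\in B_1)\cdot P(Y\in B_2)$ for all $B_1,B_2\in\mathbb{B}^1$. Support sets: with $\mathcal{B}[(x,y),\epsilon]$ the open Euclidean ball of radius $\epsilon$ centered at $(x,y)$, $$S_{XY} = \{(x,y)\in\mathbb{R}^2 : P\{(X,Y)\in\mathcal{B}[(x,y),\epsilon]\}>0 \text{ for all } \epsilon>0\},$$ $$S_X = \{x\in\mathbb{R} : P[X\in(x-\epsilon,x+\epsilon)]>0 \text{ for all } \epsilon>0\},$$ and $S_Y$ is defined analogously. Canonical PDF versions: $f_X^{C}(x^* )$ equals the derivative of $F_X$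 at $x^*$ if $F_X$ is differentiable at $x^*$, and equals $0$ otherwise; $f_Y^{C}$ is defined analogously from $F_Y$; and $f_{XY}^{C}(x^*,y^* )$ equals $\frac{\partial^2}{\partial x\,\partial y}F_{XY}(x,y)$ evaluated at $(x^*,y^* )$ if $F_{XY}$ is twice differentiable (once in $x$, once in $y$) at $(x^*,y^* )$, i.e. if this mixed partial derivative exists there, and equals $0$ otherwise. *)

theory Defs
  imports "HOL-Probability.Probability"
begin

definition joint_cdf ::
  "'a measure \<Rightarrow> ('a \<Rightarrow> real) \<Rightarrow> ('a \<Rightarrow> real) \<Rightarrow> real \<Rightarrow> real \<Rightarrow> real" where
  "joint_cdf M X Y x y = \<P>(\<omega> in M. X \<omega> \<le> x \<and> Y \<omega> \<le> y)"

text \<open>The Borel probability measure on the plane induced by a joint CDF \<open>F\<close> is determined by the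
  values of \<open>F\<close> on lower-left quadrants, so the witness \<open>\<mu>\<close> below is unique.\<close>

definition abs_cont_joint_cdf :: "(real \<Rightarrow> real \<Rightarrow> real) \<Rightarrow> bool" where
  "abs_cont_joint_cdf F \<longleftrightarrow>
     (\<exists>\<mu> :: (real \<times> real) measure.
        prob_space \<mu> \<and> sets \<mu> = sets borel \<and>
        (\<forall>x y. F x y = measure \<mu> ({..x} \<times> {..y})) \<and>
        absolutely_continuous lborel \<mu>)"

text \<open>The metric on \<^typ>\<open>real \<times> real\<close> is the Euclidean one, and on \<^typ>\<open>real\<close> the ball around \<open>x\<close> of
  radius \<open>\<epsilon>\<close> is the interval \<open>{x - \<epsilon><..<x + \<epsilon>}\<close>; the same definition thus yields both the joint
  support and the marginal supports.\<close>

definition support_set :: "'a measure \<Rightarrow> ('a \<Rightarrow> 'b::metric_space) \<Rightarrow> 'b set" where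
  "support_set M Z = {z. \<forall>\<epsilon>>0. \<P>(\<omega> in M. Z \<omega> \<in> ball z \<epsilon>) > 0}"

definition canonical_pdf :: "(real \<Rightarrow> real) \<Rightarrow> real \<Rightarrow> real" where
  "canonical_pdf F x = (if F differentiable (at x) then deriv F x else 0)"

text \<open>\<open>F\<close> has mixed partial derivative \<open>D\<close> at \<open>(x, y)\<close>: the partial derivative in the second
  argument exists along a neighbourhood of \<open>x\<close> and is itself differentiable in the first argument.\<close>

definition has_mixed_partial ::
  "(real \<Rightarrow> real \<Rightarrow> real) \<Rightarrow> real \<Rightarrow> real \<Rightarrow> real \<Rightarrow> bool" where
  "has_mixed_partial F D x y \<longleftrightarrow>
     (\<exists>g. (\<forall>\<^sub>F u in nhds x. (F u has_real_derivative g u) (at y)) \<and>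
          (g has_real_derivative D) (at x))"

definition canonical_joint_pdf :: "(real \<Rightarrow> real \<Rightarrow> real) \<Rightarrow> real \<Rightarrow> real \<Rightarrow> real" where
  "canonical_joint_pdf F x y =
     (if \<exists>D. has_mixed_partial F D x y then THE D. has_mixed_partial F D x y else 0)"

end

theory Submission imports Defs begin

text \<open>A point is in a support when each of its neighbourhoods has positive mass, and any
  neighbourhood base may be used to test this. In a product metric space the rectangles
  \<open>ball x \<epsilon> \<times> ball y \<epsilon>\<close> form a base at \<open>(x, y)\<close> which is nested with the base of Euclidean balls
  (\<open>ball_Pair_subset_Times\<close>, \<open>Times_half_balls_subset_ball_Pair\<close>). Under independence the mass
  of a rectangle is the product of the masses of its sides, so it is positive exactly when both
  sides have positive mass. This is
  carried out for random variables with values in a separable metric space, where balls in the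
  product are Borel for the product \<open>\<sigma>\<close>-algebra and so have a well-defined joint mass
  (\<open>support_set_Pair_indep\<close>).\<close>

lemma ball_Pair_subset_Times:
  "ball (x, y) e \<subseteq> ball x e \<times> ball y e"
proof clarify
  fix a b assume "(a, b) \<in> ball (x, y) e"
  then show "a \<in> ball x e \<and> b \<in> ball y e"
    using dist_fst_le[of "(x, y)" "(a, b)"] dist_snd_le[of "(x, y)" "(a, b)"] by auto
qed

text \<open>The triangle inequality for the path that moves one coordinate at a time: the Euclidean
  distance of two pairs is at most the sum of the coordinate distances, each below \<open>e / 2\<close>.\<close>

lemma Times_half_balls_subset_ball_Pair:
  "ball x (e / 2) \<times> ball y (e / 2) \<subseteq> ball (x, y) e"
proof clarify
  fix a b assume "a \<in> ball x (e / 2)" "b \<in> ball y (e / 2)"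
  moreover have "dist (x, y) (a, b) \<le> dist x a + dist y b"
    by (simp add: dist_Pair_Pair sqrt_sum_squares_le_sum)
  ultimately show "(a, b) \<in> ball (x, y) e" by simp
qed

text \<open>Independence turns the nesting of rectangles and balls into a two-sided estimate of the joint
  mass of \<open>ball (x, y) e\<close> by products of marginal masses, at radius \<open>e\<close> from above and at radius
  \<open>e / 2\<close> from below. Since positivity is required at every radius, the loss of the factor 2
  is harmless.\<close>

lemma (in prob_space) support_set_Pair_indep:
  fixes X Y :: "'a \<Rightarrow> 'b::{metric_space, second_countable_topology}"
  assumes indep: "indep_var borel X borel Y"
  shows "support_set M (\<lambda>\<omega>. (X \<omega>, Y \<omega>)) = support_set M X \<times> support_set M Y"
proof -
  have [measurable]: "random_variable borel X" "random_variable borel Y"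
    using indep by (auto dest: indep_var_rv1 indep_var_rv2)
  have XY [measurable]: "random_variable borel (\<lambda>\<omega>. (X \<omega>, Y \<omega>))"
    by (simp add: borel_prod[symmetric])
  have rectangle: "\<P>(\<omega> in M. X \<omega> \<in> ball x e \<and> Y \<omega> \<in> ball y e)
      = \<P>(\<omega> in M. X \<omega> \<in> ball x e) * \<P>(\<omega> in M. Y \<omega> \<in> ball y e)" for x y e
    using indep_varD[OF indep, of "ball x e" "ball y e"]
    by (simp add: vimage_def Int_def conj_commute)
  have outer: "\<P>(\<omega> in M. (X \<omega>, Y \<omega>) \<in> ball (x, y) e)
      \<le> \<P>(\<omega> in M. X \<omega> \<in> ball x e) * \<P>(\<omega> in M. Y \<omega> \<in> ball y e)" for x y e
    unfolding rectangle[symmetric]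
    using ball_Pair_subset_Times[of x y e] by (intro finite_measure_mono) auto
  have inner: "\<P>(\<omega> in M. X \<omega> \<in> ball x (e / 2)) * \<P>(\<omega> in M. Y \<omega> \<in> ball y (e / 2))
      \<le> \<P>(\<omega> in M. (X \<omega>, Y \<omega>) \<in> ball (x, y) e)" for x y e
    unfolding rectangle[symmetric]
    using Times_half_balls_subset_ball_Pair[of x e y]
    by (intro finite_measure_mono measurable_sets_Collect[OF XY]) (auto simp del: mem_ball)
  have "(x, y) \<in> support_set M (\<lambda>\<omega>. (X \<omega>, Y \<omega>)) \<longleftrightarrow> x \<in> support_set M X \<and> y \<in> support_set M Y"
    (is "?joint \<longleftrightarrow> ?marginals") for x y
  proof
    assume ?joint
    then have "\<P>(\<omega> in M. X \<omega> \<in> ball x e) * \<P>(\<omega> in M. Y \<omega> \<in> ball y e) > 0" if "e > 0" for e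
      using outer[of x y e] that unfolding support_set_def by fastforce
    then show ?marginals
      unfolding support_set_def mem_Collect_eq
      by (simp add: zero_less_mult_iff measure_le_0_iff)
  next
    assume marginals: ?marginals
    show ?joint
      unfolding support_set_def
    proof (intro CollectI allI impI)
      fix e :: real assume "e > 0"
      then have "0 < \<P>(\<omega> in M. X \<omega> \<in> ball x (e / 2)) * \<P>(\<omega> in M. Y \<omega> \<in> ball y (e / 2))"
        using marginals unfolding support_set_def
        by (intro mult_pos_pos) (use half_gt_zero in blast)+
      then show "0 < \<P>(\<omega> in M. (X \<omega>, Y \<omega>) \<in> ball (x, y) e)"
        using inner[of x e y] by linarith
    qed
  qed
  then show ?thesis by auto
qed

theorem proposition3:
  fixes P :: "(real \<times> real) measure"
    and S_XY :: "(real \<times> real) set" and S_X S_Y :: "real set"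
    and f_XY :: "real \<Rightarrow> real \<Rightarrow> real" and f_X f_Y :: "real \<Rightarrow> real"
  assumes "prob_space P" and "sets P = sets borel"
    and "abs_cont_joint_cdf (joint_cdf P fst snd)"
    and "S_XY = support_set P (\<lambda>\<omega>. (fst \<omega>, snd \<omega>))"
    and "S_X = support_set P fst"
    and "S_Y = support_set P snd"
    and "f_XY = canonical_joint_pdf (joint_cdf P fst snd)"
    and "f_X = canonical_pdf (cdf (distr P borel fst))"
    and "f_Y = canonical_pdf (cdf (distr P borel snd))"
    and "prob_space.indep_var P borel fst borel snd"
  shows "S_XY = S_X \<times> S_Y"
  using prob_space.support_set_Pair_indep[OF assms(1,10)] assms(4-6) by simp

end
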